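(* Let $X$ be a set, $\kappa$ an infinite cardinal, and $c:[X]^{\leq\kappa}\to[X]^{\leq 2^{\kappa}}$ an operator. For each $x\in X$ let $\{V(x,\alpha):\alpha<\kappa\}$ be a collection of subsets of $X$. Assume the following two properties. (1) (Expansive function) There is an expansive function $h$ which assigns to the union $\bigcup\mathcal{S}$ of each family $\mathcal{S}\in[\{V(x,\alpha):x\in X,\alpha<\kappa\}]^{\leq\kappa}$ a subset $h(\bigcup\mathcal{S})$ of $X$; that is, $\bigcup\mathcal{S}\subseteq h(\bigcup\mathcal{S})\subseteq X$ for every such $\mathcal{S}$. (2) (Cover-separation condition) If $\varnothing\neq H\in[X]^{\leq 2^{\kappa}}$ and $c(A)\subseteq H$ for all $A\in[H]^{\leq\kappa}$, then for every $q\in X\setminus H$ there exist $A\in[H]^{\leq\kappa}$ and a function $f:A\to\kappa$ such that $$\left|H\setminus h\Big(\bigcup_{x\in A}V(x,f(x))\Big)\right|<2^{\kappa}\quad\text{and}\quad q\notin h\Big(\bigcup_{x\in A}V(x,f(x))\Big).$$ Then $|X|\leq 2^{\kappa}$.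
   Context: For a set $A$ and a cardinal $\mu$, $[A]^{\leq\mu}=\{B:B\subseteq A,\ |B|\leq\mu\}$. For families $\mathcal{S},\mathcal{T}\subseteq\mathcal{P}(X)$, a function $f:\mathcal{S}\to\mathcal{T}$ is an operator if for all $A,B\in\mathcal{S}$ with $A\subseteq B$ one has $A\subseteq f(A)\subseteq f(B)$. A function $h$ from a family of subsets of $X$ to subsets of $X$ is expansive if $A\subseteq h(A)$ for every $A$ in its domain. The set $X$ carries no topology. *)

theory Defs
  imports Main "HOL-Library.FuncSet"
begin

unbundle cardinal_syntax

(* Cardinals are the well-orders r with Card_order r of the BNF cardinal library.  The ordinals
   below such a cardinal \<kappa> are represented by the elements of Field \<kappa>, and 2^\<kappa> is ctwo ^c \<kappa>. *)

(* [A]^{\<le>\<mu>} *)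
definition subsets_le :: "'a set \<Rightarrow> 'b rel \<Rightarrow> 'a set set" where
  "subsets_le A \<mu> = {B. B \<subseteq> A \<and> |B| \<le>o \<mu>}"

(* Functions between families of sets are total HOL functions; only their values on the
   stated domain are ever constrained. *)
definition set_operator :: "'a set set \<Rightarrow> 'a set set \<Rightarrow> ('a set \<Rightarrow> 'a set) \<Rightarrow> bool" where
  "set_operator \<S> \<T> f \<longleftrightarrow>
     f \<in> \<S> \<rightarrow> \<T> \<and> (\<forall>A\<in>\<S>. \<forall>B\<in>\<S>. A \<subseteq> B \<longrightarrow> A \<subseteq> f A \<and> f A \<subseteq> f B)"

definition expansive_on :: "'a set set \<Rightarrow> ('a set \<Rightarrow> 'a set) \<Rightarrow> bool" where
  "expansive_on \<D> h \<longleftrightarrow> (\<forall>A\<in>\<D>. A \<subseteq> h A)"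

end

theory Submission
  imports Defs
begin

text \<open>
  Write \<open>\<mu>\<close> for \<open>2\<^sup>\<kappa>\<close>. The proof is a closing-off argument that rests on
  \<open>\<mu>\<^sup>\<kappa> = \<mu>\<close>: a set of size at most \<open>\<mu>\<close> has at most \<open>\<mu>\<close> subsets of size at most \<open>\<kappa>\<close>, so
  closing it off under an operation that sends each such subset to at most \<open>\<mu>\<close> points
  (\<open>closed_superset\<close>, an iteration of length \<open>\<kappa>\<^sup>+\<close>) does not increase its size beyond \<open>\<mu>\<close>.

  To every set \<open>W\<close> attach a part \<open>M W\<close> of \<open>X - h W\<close> that has size at most \<open>\<mu>\<close> but is as large
  as this bound allows: if \<open>M W\<close> has fewer than \<open>\<mu>\<close> elements then it is all of \<open>X - h W\<close>
  (\<open>truncation\<close>). Let \<open>H\<close> be a nonempty set of size at most \<open>\<mu>\<close> that contains \<open>c A\<close> for each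
  \<open>A \<in> [H]\<^sup>\<le>\<^sup>\<kappa>\<close> and contains \<open>M W\<close> for each union \<open>W\<close> of at most \<open>\<kappa>\<close> sets \<open>V x \<alpha>\<close> with
  \<open>x \<in> H\<close>. If \<open>X\<close> had a point \<open>q\<close> outside \<open>H\<close>, the cover-separation condition would give such
  a \<open>W\<close> with \<open>q \<notin> h W\<close> and with fewer than \<open>\<mu>\<close> points of \<open>H\<close> outside \<open>h W\<close>. Since
  \<open>M W \<subseteq> H - h W\<close>, also \<open>M W\<close> has fewer than \<open>\<mu>\<close> elements, so \<open>M W = X - h W\<close>
  contains \<open>q\<close>, and \<open>q \<in> H\<close> after all. Hence \<open>X \<subseteq> H\<close>.
\<close>

text \<open>
  Every nonempty set of size at most \<open>\<kappa>\<close> is the range of a function on \<open>\<kappa>\<close>, so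
  together with the empty set there are at most \<open>1 + \<mu>\<^sup>\<kappa>\<close> of them in \<open>S\<close>.
\<close>

lemma card_subsets_le:
  fixes S :: "'a set" and \<kappa> :: "'k rel" and \<mu> :: "'l rel"
  assumes kappa: "Card_order \<kappa>" and mu: "Cinfinite \<mu>" "\<mu> ^c \<kappa> \<le>o \<mu>"
    and S: "|S| \<le>o \<mu>"
  shows "|subsets_le S \<kappa>| \<le>o \<mu>"
proof -
  let ?R = "(\<lambda>g. g ` Field \<kappa>) ` Func (Field \<kappa>) S"
  have "subsets_le S \<kappa> \<subseteq> {{}} \<union> ?R"
  proof
    fix A assume "A \<in> subsets_le S \<kappa>"
    then have A: "A \<subseteq> S" "|A| \<le>o \<kappa>" by (auto simp: subsets_le_def)
    show "A \<in> {{}} \<union> ?R"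
    proof (cases "A = {}")
      case False
      have "|A| \<le>o |Field \<kappa>|"
        using A(2) ordIso_symmetric[OF card_of_Field_ordIso[OF kappa]]
        by (rule ordLeq_ordIso_trans)
      then obtain g where g: "g ` Field \<kappa> = A"
        unfolding card_of_ordLeq2[OF False, symmetric] by blast
      let ?g = "\<lambda>a. if a \<in> Field \<kappa> then g a else undefined"
      have "?g \<in> Func (Field \<kappa>) S" using g A(1) by (auto simp: Func_def)
      moreover have "?g ` Field \<kappa> = A" using g by auto
      ultimately show ?thesis by blast
    qed simp
  qed
  moreover have "|{{}} \<union> ?R| \<le>o \<mu>"
  proof (rule Un_Cinfinite_bound)
    have "|S| ^c \<kappa> \<le>o \<mu> ^c \<kappa>" by (rule cexp_mono1[OF S kappa])
    then have "|Func (Field \<kappa>) S| \<le>o \<mu>"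
      using mu(2) by (auto simp: cexp_def Field_card_of intro: ordLeq_transitive)
    then show "|?R| \<le>o \<mu>" by (rule ordLeq_transitive[OF card_of_image])
    show "|{{}}| \<le>o \<mu>"
      using mu(1) by (auto simp: cinfinite_def intro: Card_order_singl_ordLeq)
  qed (rule mu(1))
  ultimately show ?thesis by (rule ordLeq_transitive[OF card_of_mono1])
qed

text \<open>
  The operation is iterated \<open>\<kappa>\<^sup>+\<close> times. Since \<open>\<kappa> < 2\<^sup>\<kappa> \<le> \<mu>\<^sup>\<kappa> \<le> \<mu>\<close>,
  the number \<open>\<kappa>\<^sup>+\<close> of stages is at most \<open>\<mu>\<close>, so by induction every stage has size at most \<open>\<mu>\<close>,
  and so has their union. This union is closed because
  \<open>\<kappa>\<^sup>+\<close> is regular: a subset of size at most \<open>\<kappa>\<close> already lies in some stage, and its image lies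
  in a later one.
\<close>

lemma closed_superset:
  fixes X S :: "'a set" and \<kappa> :: "'k rel" and \<mu> :: "'l rel" and F :: "'a set \<Rightarrow> 'a set"
  assumes kappa: "Cinfinite \<kappa>" and mu: "Cinfinite \<mu>" "\<mu> ^c \<kappa> \<le>o \<mu>"
    and S: "S \<in> subsets_le X \<mu>"
    and F: "F \<in> subsets_le X \<kappa> \<rightarrow> subsets_le X \<mu>"
  obtains H where "S \<subseteq> H" "H \<in> subsets_le X \<mu>" "\<And>A. A \<in> subsets_le H \<kappa> \<Longrightarrow> F A \<subseteq> H"
proof -
  have kc: "Card_order \<kappa>" using kappa by simp
  have lc: "Card_order \<mu>" using mu by simp
  let ?r = "cardSuc \<kappa>"
  have rc: "Card_order ?r" using kc by (rule cardSuc_Card_order)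
  have rinf: "Cinfinite ?r" using kappa by (rule Cinfinite_cardSuc)
  have wo: "Well_order ?r" using rc by (simp add: card_order_on_def)
  then have wr: "wo_rel ?r" by (simp add: wo_rel_def)
  have "ctwo \<le>o \<mu>" using mu(1) by (rule ctwo_ordLeq_Cinfinite)
  then have "ctwo ^c \<kappa> \<le>o \<mu> ^c \<kappa>" by (rule cexp_mono1[OF _ kc])
  then have "\<kappa> <o \<mu> ^c \<kappa>" by (rule ordLess_ordLeq_trans[OF ordLess_ctwo_cexp[OF kc]])
  then have "\<kappa> <o \<mu>" using mu(2) by (rule ordLess_ordLeq_trans)
  then have r_mu: "?r \<le>o \<mu>" using cardSuc_least[OF kc lc] by blast

  define G where "G = (\<lambda>T. T \<union> (\<Union>A\<in>subsets_le T \<kappa>. F A))"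
  define step where "step = (\<lambda>K i. S \<union> (\<Union>j\<in>underS ?r i. G (K j)))"
  define K where "K = wo_rel.worec ?r step"
  have "wo_rel.adm_wo ?r step"
    unfolding wo_rel.adm_wo_def[OF wr] step_def by auto
  then have "K = step K"
    unfolding K_def by (rule wo_rel.worec_fixpoint[OF wr])
  then have K: "K i = S \<union> (\<Union>j\<in>underS ?r i. G (K j))" for i
    unfolding step_def by metis

  have G_small: "G T \<in> subsets_le X \<mu>" if T: "T \<in> subsets_le X \<mu>" for T
  proof -
    have sub: "subsets_le T \<kappa> \<subseteq> subsets_le X \<kappa>"
      using T by (auto simp: subsets_le_def)
    have FA: "F A \<in> subsets_le X \<mu>" if "A \<in> subsets_le T \<kappa>" for A
      using that sub F by blast
    have "|subsets_le T \<kappa>| \<le>o \<mu>"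
      using card_subsets_le[OF kc mu] T by (auto simp: subsets_le_def)
    then have "|\<Union>A\<in>subsets_le T \<kappa>. F A| \<le>o \<mu>"
      using UNION_Cinfinite_bound[OF _ _ mu(1)] FA by (auto simp: subsets_le_def)
    then have "|G T| \<le>o \<mu>"
      unfolding G_def using Un_Cinfinite_bound[OF _ _ mu(1)] T by (auto simp: subsets_le_def)
    moreover have "G T \<subseteq> X"
      unfolding G_def using T FA by (auto simp: subsets_le_def)
    ultimately show ?thesis by (simp add: subsets_le_def)
  qed

  have UN_small: "(\<Union>i\<in>I. L i) \<in> subsets_le X \<mu>"
    if "|I| \<le>o \<mu>" "\<And>i. i \<in> I \<Longrightarrow> L i \<in> subsets_le X \<mu>" for I :: "'k set set" and L
    using UNION_Cinfinite_bound[OF that(1) _ mu(1), of L] that(2)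
    by (auto simp: subsets_le_def)
  have underS_small: "|underS ?r i| \<le>o \<mu>" for i
  proof -
    have "|Field ?r| \<le>o \<mu>"
      using card_of_Field_ordIso[OF rc] r_mu ordIso_ordLeq_trans by blast
    moreover have "underS ?r i \<subseteq> Field ?r" by (auto simp: underS_def Field_def)
    ultimately show ?thesis using card_of_mono1 ordLeq_transitive by blast
  qed
  have K_small: "K i \<in> subsets_le X \<mu>" for i
  proof (induction i rule: wo_rel.well_order_induct[OF wr])
    case (1 i)
    then have "(\<Union>j\<in>underS ?r i. G (K j)) \<in> subsets_le X \<mu>"
      by (intro UN_small underS_small G_small) (auto simp: underS_def)
    then show ?case
      using S Un_Cinfinite_bound[OF _ _ mu(1)] by (subst K) (auto simp: subsets_le_def)
  qed

  have chain: "relChain ?r K"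
    unfolding relChain_def
  proof (intro allI impI)
    fix i j assume "(i, j) \<in> ?r"
    then have "underS ?r i \<subseteq> underS ?r j"
      by (rule underS_incr[OF wo_rel.TRANS[OF wr] wo_rel.ANTISYM[OF wr]])
    then show "K i \<subseteq> K j" unfolding K[of i] K[of j] by blast
  qed

  let ?H = "\<Union>i\<in>Field ?r. K i"
  show thesis
  proof (rule that[of ?H])
    have "Field ?r \<noteq> {}" using rinf by (auto simp: cinfinite_def)
    then show "S \<subseteq> ?H" using K by blast
    show "?H \<in> subsets_le X \<mu>"
      by (intro UN_small K_small ordIso_ordLeq_trans[OF card_of_Field_ordIso[OF rc] r_mu])
    fix A assume A: "A \<in> subsets_le ?H \<kappa>"
    then obtain i where i: "i \<in> Field ?r" "A \<subseteq> K i"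
      using cardSuc_UNION_Cinfinite[OF kappa chain, of A] by (auto simp: subsets_le_def)
    obtain j where j: "j \<in> Field ?r" "i \<noteq> j" "(i, j) \<in> ?r"
      using infinite_Card_order_limit[OF rc _ i(1)] rinf by (auto simp: cinfinite_def)
    have "F A \<subseteq> G (K i)"
      using A i(2) by (auto simp: G_def subsets_le_def)
    also have "\<dots> \<subseteq> K j" using j K[of j] by (auto simp: underS_def)
    finally show "F A \<subseteq> ?H" using j(1) by blast
  qed
qed

lemma truncation:
  fixes Y :: "'a set" and \<mu> :: "'l rel"
  assumes mu: "Card_order \<mu>"
  obtains M where "M \<subseteq> Y" "|M| \<le>o \<mu>" "|M| <o \<mu> \<Longrightarrow> M = Y"
proof (cases "|Y| \<le>o \<mu>")
  case True
  then show ?thesis using that[of Y] by blast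
next
  case False
  have lF: "|Field \<mu>| =o \<mu>" using mu by (rule card_of_Field_ordIso)
  have "\<mu> \<le>o |Y|"
    using False mu card_of_Well_order ordLeq_total by (auto simp: card_order_on_def)
  then have "|Field \<mu>| \<le>o |Y|" using lF ordIso_ordLeq_trans by blast
  then obtain g where g: "inj_on g (Field \<mu>)" "g ` Field \<mu> \<subseteq> Y"
    unfolding card_of_ordLeq[symmetric] by blast
  then have "|Field \<mu>| =o |g ` Field \<mu>|"
    unfolding card_of_ordIso[symmetric] using inj_on_imp_bij_betw by blast
  then have eq: "|g ` Field \<mu>| =o \<mu>"
    using lF ordIso_symmetric ordIso_transitive by blast
  show ?thesis
  proof (rule that[of "g ` Field \<mu>"])
    show "|g ` Field \<mu>| \<le>o \<mu>" using eq by (rule ordIso_imp_ordLeq)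
    show "g ` Field \<mu> = Y" if "|g ` Field \<mu>| <o \<mu>"
      using that eq not_ordLess_ordIso by blast
  qed (rule g(2))
qed

theorem mainTheorem1:
  fixes X :: "'a set"
    and \<kappa> :: "'k rel"
    and c h :: "'a set \<Rightarrow> 'a set"
    and V :: "'a \<Rightarrow> 'k \<Rightarrow> 'a set"
  assumes kappa: "Card_order \<kappa>" "cinfinite \<kappa>"
    and c: "set_operator (subsets_le X \<kappa>) (subsets_le X (ctwo ^c \<kappa>)) c"
    and V: "\<And>x \<alpha>. x \<in> X \<Longrightarrow> \<alpha> \<in> Field \<kappa> \<Longrightarrow> V x \<alpha> \<subseteq> X"
    and h_fun: "h \<in> Union ` subsets_le {V x \<alpha> |x \<alpha>. x \<in> X \<and> \<alpha> \<in> Field \<kappa>} \<kappa> \<rightarrow> Pow X"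
    and h_expansive:
      "expansive_on (Union ` subsets_le {V x \<alpha> |x \<alpha>. x \<in> X \<and> \<alpha> \<in> Field \<kappa>} \<kappa>) h"
    and cover_separation:
      "\<And>H q. H \<in> subsets_le X (ctwo ^c \<kappa>) \<Longrightarrow> H \<noteq> {} \<Longrightarrow>
         (\<And>A. A \<in> subsets_le H \<kappa> \<Longrightarrow> c A \<subseteq> H) \<Longrightarrow> q \<in> X - H \<Longrightarrow>
         \<exists>A \<in> subsets_le H \<kappa>. \<exists>f \<in> A \<rightarrow> Field \<kappa>.
           |H - h (\<Union>x\<in>A. V x (f x))| <o ctwo ^c \<kappa> \<and> q \<notin> h (\<Union>x\<in>A. V x (f x))"
  shows "|X| \<le>o ctwo ^c \<kappa>"
proof (cases "X = {}")
  case True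
  then show ?thesis by (simp add: card_of_empty1 Card_order_cexp)
next
  case False
  then obtain x0 where x0: "x0 \<in> X" by blast
  define \<mu> where "\<mu> = ctwo ^c \<kappa>"
  have kinf: "Cinfinite \<kappa>" using kappa by simp
  have linf: "Cinfinite \<mu>"
    unfolding \<mu>_def using kinf by (intro Cinfinite_cexp) (auto simp: ordLeq_refl Card_order_ctwo)
  have lpow: "\<mu> ^c \<kappa> \<le>o \<mu>"
    unfolding \<mu>_def using kinf Cinfinite_Cnotzero[OF kinf]
    by (intro cexp_cprod_ordLeq[THEN ordIso_imp_ordLeq]) (auto simp: Card_order_ctwo ordLeq_refl)
  have k_mu: "\<kappa> \<le>o \<mu>"
    unfolding \<mu>_def using kappa(1) by (intro ordLess_imp_ordLeq ordLess_ctwo_cexp)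

  have "\<forall>W. \<exists>M. M \<subseteq> X - h W \<and> |M| \<le>o \<mu> \<and> ( |M| <o \<mu> \<longrightarrow> M = X - h W)"
    using truncation[of \<mu>] linf by metis
  then obtain M where M: "\<And>W. M W \<subseteq> X - h W" "\<And>W. |M W| \<le>o \<mu>"
    "\<And>W. |M W| <o \<mu> \<Longrightarrow> M W = X - h W"
    by metis
  \<comment> \<open>A union of at most \<open>\<kappa>\<close> sets \<open>V x \<alpha>\<close> is coded by a set \<open>P\<close> of pairs, so that these unions can
      be counted by the same bound as the subsets of size at most \<open>\<kappa>\<close>.\<close>
  define F where "F = (\<lambda>A. c A \<union>
    (\<Union>P\<in>subsets_le (A \<times> Field \<kappa>) \<kappa>. M (\<Union>(x, \<alpha>)\<in>P. V x \<alpha>)))"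
  have "F \<in> subsets_le X \<kappa> \<rightarrow> subsets_le X \<mu>"
  proof
    fix A assume A: "A \<in> subsets_le X \<kappa>"
    have cA: "c A \<in> subsets_le X \<mu>"
      using c A by (auto simp: set_operator_def \<mu>_def)
    have "|A| \<le>o \<mu>" using A k_mu ordLeq_transitive by (auto simp: subsets_le_def)
    moreover have "|Field \<kappa>| \<le>o \<mu>"
      using card_of_Field_ordIso[OF kappa(1)] k_mu ordIso_ordLeq_trans by blast
    ultimately have "|A \<times> Field \<kappa>| \<le>o \<mu>"
      using linf by (intro card_of_Times_ordLeq_infinite_Field) (auto simp: cinfinite_def)
    then have "|subsets_le (A \<times> Field \<kappa>) \<kappa>| \<le>o \<mu>"
      by (rule card_subsets_le[OF kappa(1) linf lpow])
    then have "|\<Union>P\<in>subsets_le (A \<times> Field \<kappa>) \<kappa>. M (\<Union>(x, \<alpha>)\<in>P. V x \<alpha>)| \<le>o \<mu>"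
      using M(2) linf by (intro UNION_Cinfinite_bound) auto
    then have "|F A| \<le>o \<mu>"
      unfolding F_def using cA linf by (intro Un_Cinfinite_bound) (auto simp: subsets_le_def)
    moreover have "F A \<subseteq> X"
      unfolding F_def using cA M(1) by (fastforce simp: subsets_le_def)
    ultimately show "F A \<in> subsets_le X \<mu>" by (simp add: subsets_le_def)
  qed
  moreover have "{x0} \<in> subsets_le X \<mu>"
    using x0 linf
    by (auto simp: subsets_le_def cinfinite_def intro: Card_order_singl_ordLeq)
  ultimately obtain H where H: "{x0} \<subseteq> H" "H \<in> subsets_le X \<mu>"
    "\<And>A. A \<in> subsets_le H \<kappa> \<Longrightarrow> F A \<subseteq> H"
    using closed_superset[OF kinf linf lpow] by metis

  have "X \<subseteq> H"
  proof (rule ccontr)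
    assume "\<not> X \<subseteq> H"
    then obtain q where q: "q \<in> X - H" by blast
    have "c A \<subseteq> H" if "A \<in> subsets_le H \<kappa>" for A
      using H(3)[OF that] by (auto simp: F_def)
    then obtain A f where A: "A \<in> subsets_le H \<kappa>" and f: "f \<in> A \<rightarrow> Field \<kappa>"
      and small: "|H - h (\<Union>x\<in>A. V x (f x))| <o \<mu>"
      and qh: "q \<notin> h (\<Union>x\<in>A. V x (f x))"
      using cover_separation[of H q] H(1,2) q unfolding \<mu>_def by blast
    let ?W = "\<Union>x\<in>A. V x (f x)" and ?P = "(\<lambda>x. (x, f x)) ` A"
    have "|?P| \<le>o \<kappa>"
      using A by (auto simp: subsets_le_def intro: ordLeq_transitive[OF card_of_image])
    then have "?P \<in> subsets_le (A \<times> Field \<kappa>) \<kappa>"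
      using f by (auto simp: subsets_le_def)
    moreover have "(\<Union>(x, \<alpha>)\<in>?P. V x \<alpha>) = ?W" by auto
    ultimately have "M ?W \<subseteq> F A" unfolding F_def by (metis (no_types, lifting) UN_upper le_supI2)
    then have MH: "M ?W \<subseteq> H" using H(3)[OF A] by blast
    then have "|M ?W| <o \<mu>"
      using M(1)[of ?W] small card_of_mono1[of "M ?W" "H - h ?W"] ordLeq_ordLess_trans by blast
    then have "M ?W = X - h ?W" by (rule M(3))
    then show False using q qh MH by blast
  qed
  then show ?thesis
    using H(2) card_of_mono1 ordLeq_transitive unfolding \<mu>_def subsets_le_def by blast
qed

end
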